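(* If $k\ge 7$ is odd and $g=2d\ge 8$, where $d$ is an even integer, then there exists no $(k,g)$-graph with bicyclic excess $4$.
   Context: Graphs are finite and simple. A $(k,g)$-graph is a $k$-regular graph of girth $g$. For even $g=2d$ the Moore bound is $M(k,g)=2\bigl(1+(k-1)+\dots+(k-1)^{d-1}\bigr)$, and the excess of a $(k,g)$-graph of order $n$ is $n-M(k,g)$. For $k\ge 6$ and $g=2d\ge 6$, a $(k,g)$-graph $G$ of excess $4$ is bipartite of diameter $d+1$ (known theorem of Biggs and Ito). The excess graph $G(E)$ of such a graph $G$ is the graph on the vertex set of $G$ in which two vertices are adjacent if and only if their distance in $G$ is $d+1$. A $(k,g)$-graph $G$ of excess $4$ has bicyclic excess $4$ if $G(E)$ is a disjoint union of exactly two cycles. *)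

theory Defs
  imports
    "Graph_Theory.Pair_Digraph"
    "Graph_Theory.Shortest_Path"
    "HOL-Library.Extended_Nat"
begin

text \<open>
  A finite simple graph is a \<^locale>\<open>pair_graph\<close>: a finite, loop-free, symmetric set of ordered
  pairs. Each undirected edge uv is thus the two arcs (u,v) and (v,u), and the degree of a vertex
  is its out-degree.
\<close>

text \<open>
  The library's \<^const>\<open>pre_digraph.cycle\<close> also admits the closed walk u, v, u of length 2, which
  is not a cycle of an undirected graph; hence the length restriction.
\<close>

definition graph_cycle :: "'a pair_pre_digraph \<Rightarrow> ('a \<times> 'a) list \<Rightarrow> bool" where
  "graph_cycle G p \<longleftrightarrow> pre_digraph.cycle (with_proj G) p \<and> 3 \<le> length p"

definition girth :: "'a pair_pre_digraph \<Rightarrow> enat" where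
  "girth G = (INF p \<in> {p. graph_cycle G p}. enat (length p))"

definition kg_graph :: "nat \<Rightarrow> nat \<Rightarrow> 'a pair_pre_digraph \<Rightarrow> bool" where
  "kg_graph k g G \<longleftrightarrow>
     pair_graph G \<and>
     (\<forall>v \<in> pverts G. out_degree (with_proj G) v = k) \<and>
     girth G = enat g"

text \<open>The Moore bound for even girth g.\<close>

definition moore_bound_even :: "nat \<Rightarrow> nat \<Rightarrow> nat" where
  "moore_bound_even k g = 2 * (\<Sum>i < g div 2. (k - 1) ^ i)"

definition excess :: "nat \<Rightarrow> nat \<Rightarrow> 'a pair_pre_digraph \<Rightarrow> int" where
  "excess k g G = int (card (pverts G)) - int (moore_bound_even k g)"

text \<open>Every arc has weight 1, so this is the number of edges of a shortest walk, and it is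
  infinite if there is no walk.\<close>

definition graph_dist :: "'a pair_pre_digraph \<Rightarrow> 'a \<Rightarrow> 'a \<Rightarrow> ereal" where
  "graph_dist G u v = wf_digraph.\<mu> (with_proj G) (\<lambda>_. 1) u v"

text \<open>Here d is half the girth of G.\<close>

definition excess_graph :: "nat \<Rightarrow> 'a pair_pre_digraph \<Rightarrow> 'a pair_pre_digraph" where
  "excess_graph d G =
     \<lparr> pverts = pverts G,
       parcs = {(u, v). u \<in> pverts G \<and> v \<in> pverts G \<and> graph_dist G u v = ereal (real (d + 1))} \<rparr>"

text \<open>A graph consisting of the vertices and edges of a single cycle p; the converse supplies the
  reversed arcs.\<close>

definition is_cycle_graph :: "'a pair_pre_digraph \<Rightarrow> bool" where
  "is_cycle_graph H \<longleftrightarrow>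
     pair_graph H \<and>
     (\<exists>p. graph_cycle H p \<and> pverts H = fst ` set p \<and> parcs H = set p \<union> (set p)\<inverse>)"

definition disjoint_union_of_two_cycles :: "'a pair_pre_digraph \<Rightarrow> bool" where
  "disjoint_union_of_two_cycles H \<longleftrightarrow>
     (\<exists>C1 C2. is_cycle_graph C1 \<and> is_cycle_graph C2 \<and> pverts C1 \<inter> pverts C2 = {} \<and>
        pverts H = pverts C1 \<union> pverts C2 \<and> parcs H = parcs C1 \<union> parcs C2)"

definition bicyclic_excess_4 :: "nat \<Rightarrow> nat \<Rightarrow> 'a pair_pre_digraph \<Rightarrow> bool" where
  "bicyclic_excess_4 k g G \<longleftrightarrow>
     kg_graph k g G \<and> excess k g G = 4 \<and>
     disjoint_union_of_two_cycles (excess_graph (g div 2) G)"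

end

theory Submission
  imports Defs
begin

text \<open>
  Let \<open>A\<close> be the adjacency operator and \<open>q = k - 1\<close>. Below half the girth, the relations "joined by a
  walk of length \<open>i\<close>" have operators \<open>B\<^sub>i\<close> with \<open>A B\<^sub>i = B\<^sub>i\<^sub>+\<^sub>1 + q B\<^sub>i\<^sub>-\<^sub>1\<close>, so they are polynomials in \<open>A\<close>.
  Counting arcs among the vertices that are not joined to \<open>u\<close> by a walk of length \<open>d - 1\<close> or \<open>d - 2\<close> shows
  that excess 4 together with a 2-regular excess graph forces \<open>G\<close> to be bipartite of diameter \<open>d + 1\<close>.
  For even \<open>d\<close> the excess operator is therefore \<open>K - B\<^sub>d\<^sub>-\<^sub>1\<close>, where \<open>K\<close> sums over the opposite colour
  class, and it commutes with \<open>A\<close>. Hence \<open>A\<close> maps the indicator \<open>h\<close> of one excess cycle to a function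
  that is harmonic on both cycles, i.e. \<open>A h = \<theta> h + b\<close> with an integer \<open>\<theta>\<close>. Evaluating
  \<open>K h = B\<^sub>d\<^sub>-\<^sub>1 h + 2 h\<close> at two vertices of the same colour in different cycles gives \<open>p(\<theta>) = - 2\<close>, where
  \<open>p\<close> is the polynomial with \<open>B\<^sub>d\<^sub>-\<^sub>1 = p(A)\<close>. As \<open>q\<close> is even, \<open>p(\<theta>)\<close> is odd or divisible by 4.
\<close>

section \<open>Walks in regular graphs of girth at least \<open>2 * d\<close>\<close>

locale regular_girth_graph =
  fixes V :: "'a set" and E :: "('a \<times> 'a) set" and k d :: nat
  assumes finite_V: "finite V"
    and arcs_in_V: "E \<subseteq> V \<times> V"
    and sym_E: "sym E"
    and irrefl_E: "irrefl E"
    and regular: "u \<in> V \<Longrightarrow> card (E `` {u}) = k"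
    and degree_pos: "k \<ge> 1"
    and no_short_cycle: "\<lbrakk>3 \<le> n; inj_on p {..<n}; \<And>i. i < n \<Longrightarrow> (p i, p (Suc i)) \<in> E; p n = p 0\<rbrakk>
      \<Longrightarrow> 2 * d \<le> (n::nat)"
begin

lemma finite_E: "finite E"
  using finite_V arcs_in_V finite_subset by blast

lemma walk_in_V: "u \<in> V \<Longrightarrow> (u, z) \<in> E ^^ n \<Longrightarrow> z \<in> V"
  using arcs_in_V by (cases n) (auto elim: relpow_Suc_E)

lemma image_walk_subset: "u \<in> V \<Longrightarrow> (E ^^ n) `` {u} \<subseteq> V"
  using walk_in_V by blast

lemma neighbours_subset: "E `` {u} \<subseteq> V"
  using arcs_in_V by auto

lemma finite_neighbours: "finite (E `` {u})"
  using neighbours_subset finite_V finite_subset by metis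

lemma walk_rev: "(u, z) \<in> E ^^ n \<Longrightarrow> (z, u) \<in> E ^^ n"
proof (induction n arbitrary: z)
  case (Suc n)
  then obtain y where "(u, y) \<in> E ^^ n" "(y, z) \<in> E" by (auto elim: relpow_Suc_E)
  with Suc.IH sym_E show ?case by (meson relpow_Suc_I2 symD)
qed simp

lemma walk_join: "(u, v) \<in> E ^^ m \<Longrightarrow> (v, w) \<in> E ^^ n \<Longrightarrow> (u, w) \<in> E ^^ (m + n)"
  by (auto simp: relpow_add)

lemma walk_extend2: assumes "u \<in> V" "(u, z) \<in> E ^^ n" shows "(u, z) \<in> E ^^ (n + 2)"
proof -
  have "E `` {u} \<noteq> {}" using regular[OF assms(1)] degree_pos by force
  then obtain w where "(u, w) \<in> E" by auto
  then have "(u, u) \<in> E ^^ 2" using sym_E by (auto simp: numeral_2_eq_2 dest: symD)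
  with assms(2) show ?thesis by (metis add.commute walk_join)
qed

text \<open>Only interior backtracking is excluded: the walk may turn back at its base point.\<close>

lemma nonbacktracking_closed_walk:
  assumes "n \<ge> 1" and f: "\<And>i. i < n \<Longrightarrow> (f i, f (Suc i)) \<in> E" and "f 0 = f n"
    and nb: "\<And>i. i + 2 \<le> n \<Longrightarrow> f i \<noteq> f (i + 2)"
  shows "2 * d \<le> n"
proof -
  \<comment> \<open>A smallest gap \<open>m\<close> between equal vertices of the walk bounds a
    genuine cycle: minimality makes its \<open>m\<close> vertices distinct, while
    \<open>m = 1\<close> would be a loop and \<open>m = 2\<close> a backtrack.\<close>
  define P where "P m \<longleftrightarrow> m \<ge> 1 \<and> (\<exists>i. i + m \<le> n \<and> f i = f (i + m))" for m
  define m where "m = (LEAST m. P m)"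
  have "P n" using assms unfolding P_def by force
  then have Pm: "P m" and "m \<le> n" unfolding m_def by (auto intro: LeastI Least_le)
  have least: "\<not> P l" if "l < m" for l using that not_less_Least unfolding m_def by blast
  obtain i where m1: "m \<ge> 1" and i: "i + m \<le> n" "f i = f (i + m)" using Pm unfolding P_def by auto
  have "m \<noteq> 1" using f[of i] i irrefl_E by (auto simp: irrefl_def)
  moreover have "m \<noteq> 2" using nb[of i] i by auto
  ultimately have "3 \<le> m" using m1 by linarith
  moreover have "inj_on (\<lambda>t. f (i + t)) {..<m}"
  proof (rule linorder_inj_onI)
    fix s t assume "s < t" "s \<in> {..<m}" "t \<in> {..<m}"
    then have "\<not> P (t - s)" "t - s \<ge> 1" "i + s + (t - s) \<le> n" using least i by auto
    then have "f (i + s) \<noteq> f (i + s + (t - s))" unfolding P_def by blast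
    then show "f (i + s) \<noteq> f (i + t)" using \<open>s < t\<close> by (simp add: add.assoc)
  qed auto
  ultimately have "2 * d \<le> m"
    by (rule no_short_cycle) (use f i in auto)
  with \<open>m \<le> n\<close> show ?thesis by simp
qed

lemma shorten_backtracking:
  assumes f: "\<And>i. i < n \<Longrightarrow> (f i, f (Suc i)) \<in> E" and i: "i + 2 \<le> n" "f i = f (i + 2)"
  shows "(f 0, f n) \<in> E ^^ (n - 2)"
proof -
  obtain m where m: "n = i + 2 + m" using i(1) le_Suc_ex by blast
  have "(f 0, f i) \<in> E ^^ i" using f i by (auto simp: relpow_fun_conv intro!: exI[of _ f])
  moreover have "(f (i + 2), f n) \<in> E ^^ (n - 2 - i)" using f m
    by (auto simp: relpow_fun_conv intro!: exI[of _ "\<lambda>t. f (i + 2 + t)"])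
  ultimately show ?thesis using walk_join[of "f 0" "f i" i "f n" "n - 2 - i"] i by simp
qed

text \<open>Removing a backtrack shortens a closed walk by two and keeps its length odd; once no
  backtrack is left, \<open>nonbacktracking_closed_walk\<close> applies.\<close>

lemma no_short_odd_closed_walk: "odd n \<Longrightarrow> n < 2 * d \<Longrightarrow> (u, u) \<notin> E ^^ n"
proof (induction n rule: less_induct)
  case (less n)
  show ?case
  proof
    assume "(u, u) \<in> E ^^ n"
    then obtain f where f: "f 0 = u" "f n = u" "\<And>i. i < n \<Longrightarrow> (f i, f (Suc i)) \<in> E"
      by (auto simp: relpow_fun_conv)
    have n1: "n \<ge> 1" using less.prems(1) odd_pos by fastforce
    show False
    proof (cases "\<exists>i. i + 2 \<le> n \<and> f i = f (i + 2)")
      case True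
      then have "n \<ge> 2" "(u, u) \<in> E ^^ (n - 2)" using shorten_backtracking[of n f] f by auto
      then show False using less.IH[of "n - 2"] less.prems by auto
    next
      case False
      then have "2 * d \<le> n" using nonbacktracking_closed_walk[of n f] f n1 by auto
      with less.prems show False by simp
    qed
  qed
qed

text \<open>Since \<open>z\<close> is not reached in \<open>i - 1\<close> steps, neither walk of
  length \<open>i + 1\<close> backtracks. With different first steps, going from \<open>z\<close>
  back to \<open>u\<close> along one and forth along the other would be a closed walk of length
  \<open>2 * (i + 1) < 2 * d\<close> that can turn back only at its base point
  \<open>z\<close>.\<close>

lemma unique_first_step:
  assumes i: "i \<ge> 1" "i + 2 \<le> d" and w: "(u, w) \<in> E" "(w, z) \<in> E ^^ i"
    and w': "(u, w') \<in> E" "(w', z) \<in> E ^^ i" and nr: "(u, z) \<notin> E ^^ (i - 1)"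
  shows "w = w'"
proof (rule ccontr)
  assume "w \<noteq> w'"
  have *: "\<exists>f. f 0 = u \<and> f 1 = w \<and> f (Suc i) = z \<and> (\<forall>t<Suc i. (f t, f (Suc t)) \<in> E) \<and>
      (\<forall>t. t + 2 \<le> Suc i \<longrightarrow> f t \<noteq> f (t + 2))" if w: "(u, w) \<in> E" "(w, z) \<in> E ^^ i" for w
  proof -
    obtain h where h: "h 0 = w" "h i = z" "\<And>t. t < i \<Longrightarrow> (h t, h (Suc t)) \<in> E"
      using w(2) by (auto simp: relpow_fun_conv)
    define f where "f t = (case t of 0 \<Rightarrow> u | Suc s \<Rightarrow> h s)" for t
    have f: "f 0 = u" "f 1 = w" "f (Suc i) = z" "\<And>t. t < Suc i \<Longrightarrow> (f t, f (Suc t)) \<in> E"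
      using h w(1) by (auto simp: f_def split: nat.split)
    moreover have "f t \<noteq> f (t + 2)" if "t + 2 \<le> Suc i" for t
      using shorten_backtracking[of "Suc i" f t] that f nr by (auto simp: numeral_2_eq_2)
    ultimately show ?thesis by blast
  qed
  obtain f where f: "f 0 = u" "f 1 = w" "f (Suc i) = z" "\<And>t. t < Suc i \<Longrightarrow> (f t, f (Suc t)) \<in> E"
      "\<And>t. t + 2 \<le> Suc i \<Longrightarrow> f t \<noteq> f (t + 2)" using *[OF w] by blast
  obtain f' where f': "f' 0 = u" "f' 1 = w'" "f' (Suc i) = z" "\<And>t. t < Suc i \<Longrightarrow> (f' t, f' (Suc t)) \<in> E"
      "\<And>t. t + 2 \<le> Suc i \<Longrightarrow> f' t \<noteq> f' (t + 2)" using *[OF w'] by blast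
  define c where "c t = (if t \<le> Suc i then f (Suc i - t) else f' (t - Suc i))" for t
  have "2 * d \<le> 2 * Suc i"
  proof (rule nonbacktracking_closed_walk[of _ c])
    show "c 0 = c (2 * Suc i)" using f f' by (simp add: c_def)
    fix t
    show "(c t, c (Suc t)) \<in> E" if "t < 2 * Suc i"
    proof (cases "t < Suc i")
      case True
      then have "(f (i - t), f (Suc (i - t))) \<in> E" using f(4) by auto
      with True sym_E show ?thesis by (auto simp: c_def Suc_diff_le dest: symD)
    next
      case False
      then have "(f' (t - Suc i), f' (Suc (t - Suc i))) \<in> E" using f'(4) that by auto
      moreover have "Suc (t - Suc i) = Suc t - Suc i" using False by simp
      moreover have "c t = f' (t - Suc i)" using False f f' by (auto simp: c_def le_Suc_eq)
      ultimately show ?thesis using False by (simp add: c_def)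
    qed
    show "c t \<noteq> c (t + 2)" if "t + 2 \<le> 2 * Suc i"
    proof -
      \<comment> \<open>For \<open>t = i\<close> the walk passes through \<open>u\<close>, coming
        from \<open>w\<close> and leaving to \<open>w'\<close>; the other two cases stay within
        \<open>f\<close> or within \<open>f'\<close>.\<close>
      consider "t + 2 \<le> Suc i" | "t = i" | "t \<ge> Suc i" by linarith
      then show ?thesis
      proof cases
        case 1
        then have "f (i - 1 - t) \<noteq> f (i - 1 - t + 2)" using f(5)[of "i - 1 - t"] i by auto
        moreover have "i - 1 - t + 2 = Suc i - t" "Suc i - (t + 2) = i - 1 - t" using 1 by auto
        ultimately show ?thesis using 1 by (auto simp: c_def)
      next
        case 2
        then show ?thesis using f f' \<open>w \<noteq> w'\<close> by (auto simp: c_def)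
      next
        case 3
        then have "f' (t - Suc i) \<noteq> f' (t - Suc i + 2)" using that by (intro f'(5)) auto
        moreover have "c t = f' (t - Suc i)" using 3 f f' by (auto simp: c_def le_Suc_eq)
        moreover have "c (t + 2) = f' (t - Suc i + 2)" using 3
          by (auto simp: c_def) (metis Suc_diff_le diff_Suc_Suc le_SucI)
        ultimately show ?thesis by simp
      qed
    qed
  qed auto
  with i show False by simp
qed

section \<open>Relations as 0/1 matrices acting on integer functions, and the recurrence for walk
  relations\<close>

definition rsum :: "('a \<times> 'a) set \<Rightarrow> ('a \<Rightarrow> int) \<Rightarrow> 'a \<Rightarrow> int" where
  "rsum R f u = (\<Sum>z\<in>V. of_bool ((u, z) \<in> R) * f z)"

lemma rsum_cong: "(\<And>v. v \<in> V \<Longrightarrow> f v = h v) \<Longrightarrow> rsum R f u = rsum R h u"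
  by (simp add: rsum_def)

lemma rsum_linear: "rsum R (\<lambda>v. a * f v + b * h v) u = a * rsum R f u + b * rsum R h u"
  by (simp add: rsum_def sum.distrib sum_distrib_left algebra_simps)

lemma rsum_rsum:
  "rsum R (rsum S f) u = (\<Sum>z\<in>V. int (card {w \<in> V. (u, w) \<in> R \<and> (w, z) \<in> S}) * f z)"
proof -
  have "rsum R (rsum S f) u = (\<Sum>w\<in>V. \<Sum>z\<in>V. of_bool ((u, w) \<in> R \<and> (w, z) \<in> S) * f z)"
    by (simp add: rsum_def sum_distrib_left of_bool_conj mult.assoc)
  also have "\<dots> = (\<Sum>z\<in>V. (\<Sum>w\<in>V. of_bool ((u, w) \<in> R \<and> (w, z) \<in> S)) * f z)"
    by (subst sum.swap) (simp add: sum_distrib_right)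
  also have "\<dots> = (\<Sum>z\<in>V. int (card {w \<in> V. (u, w) \<in> R \<and> (w, z) \<in> S}) * f z)"
    using finite_V by (intro sum.cong refl) (simp add: of_bool_def sum.If_cases Int_def)
  finally show ?thesis .
qed

lemma rsum_Id: "u \<in> V \<Longrightarrow> rsum (E ^^ 0) f u = f u"
  using finite_V by (simp add: rsum_def)

lemma rsum_image: "R `` {u} \<subseteq> V \<Longrightarrow> rsum R f u = (\<Sum>z\<in>R `` {u}. f z)"
  unfolding rsum_def using finite_V
  by (intro sum.mono_neutral_cong_right) auto

lemma rsum_const: "u \<in> V \<Longrightarrow> rsum E (\<lambda>_. c) u = int k * c"
  using rsum_image[OF neighbours_subset] regular by simp

text \<open>This is the entry at \<open>(u, z)\<close> of the product of the adjacency matrix with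
  the matrix of \<open>E ^^ i\<close>. If \<open>z\<close> is reached in \<open>i - 1\<close> steps,
  each of the \<open>k\<close> neighbours of \<open>u\<close> can return through \<open>u\<close>,
  and \<open>z\<close> is also reached in \<open>i + 1\<close> steps, whence
  \<open>1 + (k - 1)\<close>. Otherwise \<open>unique_first_step\<close> leaves at most one
  neighbour.\<close>

lemma card_first_steps:
  assumes u: "u \<in> V" and i: "i \<ge> 1" "i + 2 \<le> d"
  shows "int (card {w \<in> V. (u, w) \<in> E \<and> (w, z) \<in> E ^^ i}) =
    of_bool ((u, z) \<in> E ^^ (i + 1)) + (int k - 1) * of_bool ((u, z) \<in> E ^^ (i - 1))"
proof (cases "(u, z) \<in> E ^^ (i - 1)")
  case True
  have "(w, z) \<in> E ^^ i" if "(u, w) \<in> E" for w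
    using that True sym_E i relpow_Suc_I2[of w u E z "i - 1"] by (auto dest: symD)
  then have "{w \<in> V. (u, w) \<in> E \<and> (w, z) \<in> E ^^ i} = E `` {u}" using arcs_in_V by auto
  moreover have "(u, z) \<in> E ^^ (i + 1)" using walk_extend2[OF u True] i by simp
  ultimately show ?thesis using regular[OF u] True by simp
next
  case False
  show ?thesis
  proof (cases "(u, z) \<in> E ^^ (i + 1)")
    case True
    then obtain w where w: "(u, w) \<in> E" "(w, z) \<in> E ^^ i"
      by (metis Suc_eq_plus1 relpow_Suc_E2)
    have "x = w" if "(u, x) \<in> E" "(x, z) \<in> E ^^ i" for x
      by (rule unique_first_step[OF i that w False])
    then have "{w \<in> V. (u, w) \<in> E \<and> (w, z) \<in> E ^^ i} = {w}"
      using w arcs_in_V by blast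
    with True False show ?thesis by simp
  next
    case F: False
    then have "{w \<in> V. (u, w) \<in> E \<and> (w, z) \<in> E ^^ i} = {}"
      using relpow_Suc_I2[of u _ E z i] by auto
    with F False show ?thesis by (simp del: Collect_empty_eq)
  qed
qed

lemma rsum_recurrence:
  assumes "u \<in> V" "i \<ge> 1" "i + 2 \<le> d"
  shows "rsum E (rsum (E ^^ i) f) u = rsum (E ^^ (i + 1)) f u + (int k - 1) * rsum (E ^^ (i - 1)) f u"
  unfolding rsum_rsum card_first_steps[OF assms]
  by (simp add: rsum_def sum.distrib sum_distrib_left distrib_right mult.assoc del: relpow.simps)

text \<open>By \<open>rsum_recurrence\<close> the operator of \<open>E ^^ i\<close> is a polynomial
  in the adjacency operator as long as \<open>i\<close> stays below \<open>d\<close>; the induction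
  unrolls this polynomial.\<close>

lemma rsum_commute:
  assumes "u \<in> V" "i + 1 \<le> d"
  shows "rsum E (rsum (E ^^ i) f) u = rsum (E ^^ i) (rsum E f) u"
  using assms
proof (induction i arbitrary: u rule: less_induct)
  case (less i)
  consider "i = 0" | "i = 1" | j where "i = j + 1" "j \<ge> 1"
    by (metis One_nat_def Suc_eq_plus1 Suc_leI gr0I not0_implies_Suc)
  then show ?case
  proof cases
    case 1
    then show ?thesis using rsum_cong[of "rsum (E ^^ 0) f" f E u] less.prems
      by (simp add: rsum_Id del: relpow.simps)
  next
    case 2
    then show ?thesis by simp
  next
    case 3
    have rec: "rsum (E ^^ i) h v = 1 * rsum E (rsum (E ^^ j) h) v + (1 - int k) * rsum (E ^^ (j - 1)) h v"
      if "v \<in> V" for h v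
      using rsum_recurrence[OF that, of j h] 3 less.prems by (simp add: algebra_simps del: relpow.simps)
    have "rsum E (rsum (E ^^ i) f) u
        = 1 * rsum E (rsum E (rsum (E ^^ j) f)) u + (1 - int k) * rsum E (rsum (E ^^ (j - 1)) f) u"
      unfolding rsum_linear[symmetric] by (rule rsum_cong) (rule rec)
    also have "rsum E (rsum E (rsum (E ^^ j) f)) u = rsum E (rsum (E ^^ j) (rsum E f)) u"
      using less 3 by (intro rsum_cong) auto
    also have "rsum E (rsum (E ^^ (j - 1)) f) u = rsum (E ^^ (j - 1)) (rsum E f) u"
      using less 3 by auto
    finally show ?thesis using rec[OF less.prems(1)] by simp
  qed
qed

text \<open>The row sums of the walk operators satisfy the recurrence applied to the constant
  function 1. For \<open>i = d - 1\<close> the value is half the Moore bound.\<close>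

lemma card_walk_image:
  assumes "u \<in> V" "i + 1 \<le> d" shows "card ((E ^^ i) `` {u}) = (\<Sum>j<Suc i. (k - 1) ^ j)"
proof -
  define M where "M j = rsum (E ^^ j) (\<lambda>_. 1) u" for j
  have M: "M j = int (card ((E ^^ j) `` {u}))" for j
    unfolding M_def using rsum_image[OF image_walk_subset[OF assms(1)]] by simp
  have M0: "M 0 = 1" "M 1 = int k" using M assms(1) regular by auto
  have rec: "M (j + 1) = int k * M j - (int k - 1) * M (j - 1)" if "j \<ge> 1" "j + 2 \<le> d" for j
  proof -
    \<comment> \<open>The term \<open>0 * 0\<close> only brings the constant into the shape of
      \<open>rsum_linear\<close>, which then pulls out \<open>int k\<close>.\<close>
    have "rsum (E ^^ j) (rsum E (\<lambda>_. 1)) u = rsum (E ^^ j) (\<lambda>_. int k * 1 + 0 * 0) u"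
      by (rule rsum_cong) (use rsum_const[of _ 1] in auto)
    also have "\<dots> = int k * M j" unfolding rsum_linear M_def by simp
    finally have "rsum E (rsum (E ^^ j) (\<lambda>_. 1)) u = int k * M j"
      using rsum_commute[of u j "\<lambda>_. 1"] assms(1) that by simp
    then show ?thesis
      using rsum_recurrence[OF assms(1) that, of "\<lambda>_. 1"] unfolding M_def by linarith
  qed
  \<comment> \<open>With \<open>q = k - 1\<close>, the recurrence \<open>rec\<close> says that
    \<open>M (j + 1) - q * M j\<close> does not depend on \<open>j\<close>; at \<open>j = 0\<close>
    it is \<open>k - q = 1\<close>.\<close>
  have step: "M (j + 1) = 1 + (int k - 1) * M j" if "j + 2 \<le> d" for j
    using that
  proof (induction j)
    case (Suc j)
    then show ?case using rec[of "j + 1"] by (simp add: algebra_simps)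
  qed (use M0 in simp)
  have "M i = (\<Sum>j<Suc i. (int k - 1) ^ j)" using assms(2)
  proof (induction i)
    case (Suc i)
    then show ?case using step[of i]
      by (simp add: sum.lessThan_Suc_shift[of _ "Suc i"] sum_distrib_left del: sum.lessThan_Suc)
  qed (use M0 in simp)
  then have "int (card ((E ^^ i) `` {u})) = int (\<Sum>j<Suc i. (k - 1) ^ j)"
    unfolding M using degree_pos by (simp add: of_nat_diff)
  then show ?thesis by linarith
qed

lemma card_arcs_from: "P \<subseteq> V \<Longrightarrow> card (E \<inter> P \<times> V) = k * card P"
proof -
  assume P: "P \<subseteq> V"
  have "E \<inter> P \<times> V = Sigma P (\<lambda>p. E `` {p})" using arcs_in_V by auto
  then have "card (E \<inter> P \<times> V) = (\<Sum>p\<in>P. card (E `` {p}))"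
    using P finite_V finite_neighbours by (simp add: finite_subset)
  also have "\<dots> = (\<Sum>p\<in>P. k)" using P regular by (intro sum.cong) auto
  finally show ?thesis by simp
qed

lemma card_arcs_sym: "card (E \<inter> P \<times> Q) = card (E \<inter> Q \<times> P)"
proof -
  have "bij_betw prod.swap (E \<inter> P \<times> Q) (E \<inter> Q \<times> P)"
    by (rule bij_betw_byWitness[of _ prod.swap]) (use sym_E in \<open>auto dest: symD\<close>)
  then show ?thesis by (rule bij_betw_same_card)
qed

lemma card_arcs_Un: "Q \<inter> Q' = {} \<Longrightarrow> card (E \<inter> P \<times> (Q \<union> Q')) = card (E \<inter> P \<times> Q) + card (E \<inter> P \<times> Q')"
  using finite_E by (subst Sigma_Un_distrib2, subst Int_Un_distrib) (intro card_Un_disjoint, auto)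

text \<open>For the vertices and arcs of a graph this is the arc set of its excess graph, phrased by
  walks instead of distances; see \<open>excess_graph_arcs\<close>.\<close>

definition far :: "('a \<times> 'a) set" where
  "far = {(u, z) \<in> V \<times> V. (u, z) \<in> E ^^ (d + 1) \<and> (\<forall>j\<le>d. (u, z) \<notin> E ^^ j)}"

end

text \<open>
  \<open>walk_poly q t n\<close> is the rescaled Chebyshev polynomial \<open>q\<^sup>n\<^sup>/\<^sup>2 U\<^sub>n(t / (2 \<surd>q))\<close>.
\<close>

fun walk_poly :: "int \<Rightarrow> int \<Rightarrow> nat \<Rightarrow> int" where
  "walk_poly q t 0 = 1"
| "walk_poly q t (Suc 0) = t"
| "walk_poly q t (Suc (Suc n)) = t * walk_poly q t (Suc n) - q * walk_poly q t n"

text \<open>For even \<open>q\<close> the value is congruent to \<open>t ^ n\<close> modulo 2, hence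
  odd for odd \<open>t\<close>. For even \<open>t\<close> all values from index 1 on are even, so
  from index 3 on both terms of the recurrence are products of two even numbers and the value is
  divisible by 4.\<close>

lemma walk_poly_neq:
  assumes q: "even q" and n: "n \<ge> 3" shows "walk_poly q t n \<noteq> - 2"
proof (cases "even t")
  case False
  have "odd (walk_poly q t n)"
    using q False by (induction q t n rule: walk_poly.induct) auto
  then show ?thesis by force
next
  case True
  have ev: "even (walk_poly q t (Suc m))" for m
    using q True by (cases m) auto
  obtain m where m: "n = Suc (Suc (Suc m))"
    using n by (metis Suc_le_D numeral_3_eq_3 Suc_le_mono)
  have "2 * 2 dvd t * walk_poly q t (Suc (Suc m))" "2 * 2 dvd q * walk_poly q t (Suc m)"
    using True q ev by (intro mult_dvd_mono; simp)+
  then have "4 dvd walk_poly q t n" unfolding m by simp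
  then show ?thesis by presburger
qed

section \<open>Counting arcs far from a vertex in a graph of excess four\<close>

locale excess_four_graph = regular_girth_graph +
  assumes degree_ge: "k \<ge> 7"
    and d_ge: "d \<ge> 4"
    and even_d: "even d"
    and order: "card V = 2 * (\<Sum>j<d. (k - 1) ^ j) + 4"
    and card_far: "u \<in> V \<Longrightarrow> card (far `` {u}) = 2"
begin

lemma walk_extend:
  assumes "u \<in> V" "(u, z) \<in> E ^^ m" "even (n - m)" "m \<le> n"
  shows "(u, z) \<in> E ^^ n"
proof -
  have "(u, z) \<in> E ^^ (m + 2 * t)" for t
  proof (induction t)
    case (Suc t)
    from walk_extend2[OF assms(1) this] show ?case by (simp del: relpow.simps)
  qed (use assms in simp)
  moreover obtain t where "n - m = 2 * t" using assms(3) by (elim evenE)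
  ultimately show ?thesis using assms(4) by (metis le_add_diff_inverse)
qed

text \<open>By \<open>walk_extend\<close>, walks of length \<open>d - 1\<close> and
  \<open>d - 2\<close> from a vertex \<open>u\<close> together reach exactly the vertices at
  distance below \<open>d\<close>. So these are the vertices at distance at least \<open>d\<close>,
  or not reachable at all.\<close>

definition outer :: "'a \<Rightarrow> 'a set" where
  "outer u = V - (E ^^ (d - 1)) `` {u} - (E ^^ (d - 2)) `` {u}"

lemma d_minus: "d - 1 = Suc (d - 2)" "Suc (d - 1) = d"
  using d_ge by auto

lemma near_disjoint: "(E ^^ (d - 1)) `` {u} \<inter> (E ^^ (d - 2)) `` {u} = {}"
  using no_short_odd_closed_walk[of "d - 1 + (d - 2)" u] walk_join walk_rev d_ge by fastforce

lemma no_arc_within_sphere: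
  assumes "(u, w) \<in> E ^^ (d - 1)" "(u, w') \<in> E ^^ (d - 1)" shows "(w, w') \<notin> E"
proof
  assume "(w, w') \<in> E"
  then have "(u, u) \<in> E ^^ (Suc (d - 1) + (d - 1))"
    using assms walk_rev walk_join relpow_Suc_I by meson
  moreover have "odd (Suc (d - 1) + (d - 1))" "Suc (d - 1) + (d - 1) < 2 * d" using d_ge by auto
  ultimately show False using no_short_odd_closed_walk by blast
qed

lemma arc_from_near: "(u, w) \<in> E ^^ (d - 2) \<Longrightarrow> (w, w') \<in> E \<Longrightarrow> (u, w') \<in> E ^^ (d - 1)"
  using relpow_Suc_I[of u w "d - 2" E w'] d_minus(1) by simp

lemma outer_near_no_arc: "w \<in> outer u \<Longrightarrow> (u, w') \<in> E ^^ (d - 2) \<Longrightarrow> (w, w') \<notin> E"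
  using arc_from_near[of u w' w] sym_E by (auto simp: outer_def dest: symD)

text \<open>Arcs run only between \<open>X\<close> and \<open>Y\<close>, between \<open>X\<close>
  and \<open>R\<close>, and inside \<open>R\<close>. Counting the arcs that leave each set gives
  \<open>k * (card R + card Y - card X)\<close> arcs inside \<open>R\<close>, and the bracket is 4
  because \<open>card V = 2 * card X + 4\<close>.\<close>

lemma card_arcs_outer: assumes u: "u \<in> V" shows "card (E \<inter> outer u \<times> outer u) = 4 * k"
proof -
  define X Y R where "X = (E ^^ (d - 1)) `` {u}" and "Y = (E ^^ (d - 2)) `` {u}" and "R = outer u"
  have XYV: "X \<subseteq> V" "Y \<subseteq> V" "R \<subseteq> V"
    using image_walk_subset[OF u] by (auto simp: X_def Y_def R_def outer_def)
  have V: "V = X \<union> Y \<union> R" using XYV by (auto simp: X_def Y_def R_def outer_def)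
  have disj: "X \<inter> Y = {}" "X \<inter> R = {}" "Y \<inter> R = {}" "(X \<union> Y) \<inter> R = {}"
    using near_disjoint by (auto simp: X_def Y_def R_def outer_def)
  have split: "k * card P = card (E \<inter> P \<times> X) + card (E \<inter> P \<times> Y) + card (E \<inter> P \<times> R)"
    if "P \<subseteq> V" for P
    unfolding card_arcs_from[OF that, symmetric] using disj by (subst V) (simp add: card_arcs_Un)
  have "E \<inter> X \<times> X = {}" using no_arc_within_sphere[of u] by (auto simp: X_def)
  moreover have "E \<inter> Y \<times> Y = {}" "E \<inter> Y \<times> R = {}"
    using arc_from_near[of u] disj unfolding X_def Y_def by blast+
  moreover have "E \<inter> R \<times> Y = {}" using outer_near_no_arc[of _ u] by (auto simp: R_def Y_def)
  ultimately have "k * card X = card (E \<inter> X \<times> Y) + card (E \<inter> X \<times> R)"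
    "k * card Y = card (E \<inter> X \<times> Y)" "k * card R = card (E \<inter> X \<times> R) + card (E \<inter> R \<times> R)"
    using split[of X] split[of Y] split[of R] XYV card_arcs_sym[of Y X] card_arcs_sym[of R X] by auto
  moreover have "card V = card X + card Y + card R" unfolding V
    using XYV finite_V disj by (simp add: card_Un_disjoint finite_subset)
  moreover have "card V = 2 * card X + 4"
    using order card_walk_image[OF u, of "d - 1"] d_ge by (simp add: X_def)
  ultimately have "k * (card Y + card R) = k * (card X + 4)" "k * card X = k * card Y + card (E \<inter> X \<times> R)"
    "k * card R = card (E \<inter> X \<times> R) + card (E \<inter> R \<times> R)" by simp_all
  then show ?thesis unfolding R_def[symmetric] distrib_left by linarith
qed

text \<open>The left-hand set \<open>F\<close> consists of the vertices reached in neither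
  \<open>d - 1\<close> nor \<open>d\<close> steps. All its arcs stay in \<open>outer u\<close>, so
  \<open>card_arcs_outer\<close> bounds its size by 4. A member outside \<open>far\<close> would not
  be reached in \<open>d + 1\<close> steps either, which would put all its \<open>k\<close>
  neighbours into \<open>F\<close>.\<close>

lemma outer_without_far:
  assumes u: "u \<in> V" shows "{w \<in> outer u. E `` {w} \<subseteq> outer u} = far `` {u}"
proof -
  define F where "F = {w \<in> outer u. E `` {w} \<subseteq> outer u}"
  have F_iff: "w \<in> F \<longleftrightarrow> w \<in> V \<and> (u, w) \<notin> E ^^ d \<and> (u, w) \<notin> E ^^ (d - 1)" for w
  proof
    assume w: "w \<in> F"
    have "(u, w) \<notin> E ^^ d"
    proof
      assume "(u, w) \<in> E ^^ d"
      then obtain x where "(u, x) \<in> E ^^ (d - 1)" "(x, w) \<in> E"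
        using relpow_Suc_E[of u w "d - 1" E] d_minus by metis
      then show False using w sym_E by (auto simp: F_def outer_def dest: symD)
    qed
    then show "w \<in> V \<and> (u, w) \<notin> E ^^ d \<and> (u, w) \<notin> E ^^ (d - 1)"
      using w by (auto simp: F_def outer_def)
  next
    assume w: "w \<in> V \<and> (u, w) \<notin> E ^^ d \<and> (u, w) \<notin> E ^^ (d - 1)"
    then have "(u, w) \<notin> E ^^ (d - 2)" using walk_extend[OF u, of w "d - 2" d] d_ge by auto
    with w have wo: "w \<in> outer u" by (auto simp: outer_def)
    moreover have "x \<in> outer u" if x: "(w, x) \<in> E" for x
    proof -
      have "(u, x) \<notin> E ^^ (d - 1)"
        using w x sym_E relpow_Suc_I[of u x "d - 1" E w] d_minus by (metis symD)
      then show ?thesis using x wo outer_near_no_arc arcs_in_V by (auto simp: outer_def)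
    qed
    ultimately show "w \<in> F" by (auto simp: F_def)
  qed
  have far_sub: "far `` {u} \<subseteq> F" by (auto simp: far_def F_iff)
  have "F \<subseteq> V" by (auto simp: F_iff)
  then have finF: "finite F" using finite_V finite_subset by blast
  have "E \<inter> F \<times> outer u = E \<inter> F \<times> V" using arcs_in_V by (auto simp: F_def outer_def)
  then have "k * card F = card (E \<inter> F \<times> outer u)" using card_arcs_from \<open>F \<subseteq> V\<close> by simp
  also have "\<dots> \<le> card (E \<inter> outer u \<times> outer u)"
    using finite_E by (intro card_mono) (auto simp: F_def)
  finally have cardF: "card F \<le> 4" using card_arcs_outer[OF u] degree_ge by simp
  have "w \<in> far `` {u}" if w: "w \<in> F" for w
  proof (rule ccontr)
    assume nf: "w \<notin> far `` {u}"
    have "(u, w) \<notin> E ^^ j" if "j \<le> d" for j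
    proof (cases "even j")
      case True
      then show ?thesis using w walk_extend[OF u, of w j d] that even_d by (auto simp: F_iff)
    next
      case False
      then have "j \<le> d - 1" "even (d - 1 - j)" using that even_d by (cases "j = d"; auto)+
      then show ?thesis using w walk_extend[OF u, of w j "d - 1"] by (auto simp: F_iff)
    qed
    with nf w u have nw: "(u, w) \<notin> E ^^ (d + 1)" by (auto simp: far_def F_iff)
    have "x \<in> F" if x: "(w, x) \<in> E" for x
    proof -
      have "(u, x) \<notin> E ^^ d" using nw x sym_E relpow_Suc_I[of u x d E w] by (auto dest: symD)
      moreover have "(u, x) \<notin> E ^^ (d - 1)" using w x by (auto simp: F_def outer_def)
      ultimately show ?thesis using x arcs_in_V by (auto simp: F_iff)
    qed
    then have "E `` {w} \<subseteq> F" by auto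
    then have "k \<le> card F" using card_mono[OF finF] regular w by (force simp: F_iff)
    with cardF degree_ge show False by simp
  qed
  with far_sub show ?thesis unfolding F_def by auto
qed

text \<open>Let \<open>F\<close> be the two far vertices and \<open>Q\<close> the rest of
  \<open>outer u\<close>. All \<open>2 * k\<close> arcs from \<open>F\<close> end in
  \<open>outer u\<close>, which has \<open>4 * k\<close> inner arcs, so there are as many arcs
  inside \<open>Q\<close> as inside \<open>F\<close>, at most 2. An arc inside \<open>Q\<close> is
  then refuted by comparing walks of length \<open>d\<close> from \<open>u\<close> to its two
  ends.\<close>

lemma no_arc_within_outer:
  assumes u: "u \<in> V"
  shows "E \<inter> (outer u - far `` {u}) \<times> (outer u - far `` {u}) = {}" "E \<inter> far `` {u} \<times> far `` {u} = {}"
proof -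
  define R F Q where "R = outer u" and "F = far `` {u}" and "Q = R - F"
  have F: "F \<subseteq> R" "\<And>w. w \<in> F \<Longrightarrow> E `` {w} \<subseteq> R" "card F = 2"
    using outer_without_far[OF u] card_far[OF u] by (auto simp: R_def F_def)
  have RV: "R \<subseteq> V" by (auto simp: R_def outer_def)
  have RFQ: "R = F \<union> Q" "F \<inter> Q = {}" using F by (auto simp: Q_def)
  have finR: "finite R" "finite Q" "finite F" using RV finite_V F(1) by (auto simp: Q_def intro: finite_subset)
  have split: "card (E \<inter> P \<times> R) = card (E \<inter> P \<times> F) + card (E \<inter> P \<times> Q)" for P
    unfolding RFQ(1) using RFQ(2) by (rule card_arcs_Un)
  have "E \<inter> F \<times> R = E \<inter> F \<times> V" using F(2) RV by auto
  then have "card (E \<inter> F \<times> R) = 2 * k" using card_arcs_from[of F] F RV by auto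
  moreover have "card (E \<inter> R \<times> F) + card (E \<inter> R \<times> Q) = 4 * k"
    using split[of R] card_arcs_outer[OF u] by (simp add: R_def)
  ultimately have QQ: "card (E \<inter> Q \<times> Q) = card (E \<inter> F \<times> F)"
    using split[of F] split[of Q] card_arcs_sym[of R F] card_arcs_sym[of R Q] card_arcs_sym[of F Q] by linarith
  obtain y y' where yy: "F = {y, y'}" using F(3) by (auto simp: card_2_iff)
  have "E \<inter> F \<times> F \<subseteq> {(y, y'), (y', y)}" using irrefl_E by (auto simp: yy irrefl_def)
  then have "card (E \<inter> F \<times> F) \<le> card {(y, y'), (y', y)}" by (rule card_mono[rotated]) simp
  also have "\<dots> \<le> 2" using card_length[of "[(y, y'), (y', y)]"] by simp
  finally have FF: "card (E \<inter> F \<times> F) \<le> 2" .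
  have "E \<inter> Q \<times> Q = {}"
  proof (rule ccontr)
    assume "E \<inter> Q \<times> Q \<noteq> {}"
    then obtain w w' where ww: "(w, w') \<in> E" "w \<in> Q" "w' \<in> Q" by auto
    define T where "T v = {s \<in> V. (u, s) \<in> E \<and> (s, v) \<in> E ^^ (d - 1)}" for v
    define r where "r v = card (E `` {v} \<inter> Q)" for v
    \<comment> \<open>An element common to \<open>T w\<close> and \<open>T w'\<close> would lie on a closed walk of odd length \<open>2 d - 1\<close>.\<close>
    have T: "k \<le> card (T v) + 2 + r v" if v: "v \<in> Q" for v
    proof -
      have vV: "v \<in> V" using v RV by (auto simp: Q_def)
      \<comment> \<open>Applied to the indicator of \<open>v\<close>, the commutation rule compares
        matrix entries at \<open>(u, v)\<close>: the neighbours of \<open>u\<close> joined to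
        \<open>v\<close> by \<open>d - 1\<close> steps are as many as the neighbours of
        \<open>v\<close> joined to \<open>u\<close> by \<open>d - 1\<close> steps.\<close>
      define h :: "'a \<Rightarrow> int" where "h z = of_bool (z = v)" for z
      have h: "(\<Sum>z\<in>V. c z * h z) = c v" for c using vV finite_V by (simp add: h_def of_bool_def if_distrib cong: if_cong)
      have "rsum E (rsum (E ^^ (d - 1)) h) u = rsum (E ^^ (d - 1)) (rsum E h) u"
        using u d_ge by (intro rsum_commute) auto
      then have "card (T v) = card {x \<in> V. (u, x) \<in> E ^^ (d - 1) \<and> (x, v) \<in> E}"
        unfolding rsum_rsum h T_def by simp
      also have "{x \<in> V. (u, x) \<in> E ^^ (d - 1) \<and> (x, v) \<in> E} = E `` {v} \<inter> (E ^^ (d - 1)) `` {u}"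
        using sym_E arcs_in_V by (auto dest: symD)
      finally have T: "card (T v) = card (E `` {v} \<inter> (E ^^ (d - 1)) `` {u})" .
      have vo: "v \<in> outer u" using v by (auto simp: Q_def R_def)
      have sub: "E `` {v} \<subseteq> (E `` {v} \<inter> (E ^^ (d - 1)) `` {u}) \<union> F \<union> (E `` {v} \<inter> Q)"
        using outer_near_no_arc[OF vo] arcs_in_V by (auto simp: Q_def R_def outer_def)
      then have "k \<le> card ((E `` {v} \<inter> (E ^^ (d - 1)) `` {u}) \<union> F \<union> (E `` {v} \<inter> Q))"
        using regular[OF vV] card_mono[OF _ sub] finR finite_neighbours by simp
      also have "\<dots> \<le> card (E `` {v} \<inter> (E ^^ (d - 1)) `` {u}) + card F + r v"
        unfolding r_def
        using card_Un_le[of "(E `` {v} \<inter> (E ^^ (d - 1)) `` {u}) \<union> F" "E `` {v} \<inter> Q"]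
          card_Un_le[of "E `` {v} \<inter> (E ^^ (d - 1)) `` {u}" F] by linarith
      finally show ?thesis using T F(3) by simp
    qed
    have "T w \<inter> T w' = {}" unfolding T_def using no_arc_within_sphere ww(1) by fastforce
    moreover have "finite (T w)" "finite (T w')" "T w \<union> T w' \<subseteq> E `` {u}"
      using finite_V by (auto simp: T_def)
    ultimately have TT: "card (T w) + card (T w') \<le> k"
      using card_mono[OF finite_neighbours, of "T w \<union> T w'" u] regular[OF u] by (simp add: card_Un_disjoint)
    have "w \<noteq> w'" using ww irrefl_E by (auto simp: irrefl_def)
    then have "r w + r w' = card ({w} \<times> (E `` {w} \<inter> Q) \<union> {w'} \<times> (E `` {w'} \<inter> Q))"
      using finite_neighbours by (subst card_Un_disjoint) (auto simp: r_def card_cartesian_product)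
    also have "\<dots> \<le> card (E \<inter> Q \<times> Q)" using ww finite_E by (intro card_mono) auto
    finally have "r w + r w' \<le> 2" using QQ FF by simp
    \<comment> \<open>The two bounds add up to \<open>2 * k \<le> k + 4 + 2\<close>, which fails
      from \<open>k = 7\<close> on.\<close>
    with T[OF ww(2)] T[OF ww(3)] TT degree_ge show False by linarith
  qed
  moreover from this have "E \<inter> F \<times> F = {}" using QQ finite_E by simp
  ultimately show "E \<inter> (outer u - far `` {u}) \<times> (outer u - far `` {u}) = {}" "E \<inter> far `` {u} \<times> far `` {u} = {}"
    by (simp_all add: Q_def R_def F_def)
qed

section \<open>Bipartition and diameter\<close>

definition odd_set :: "'a \<Rightarrow> 'a set" where
  "odd_set u = (E ^^ (d - 1)) `` {u} \<union> far `` {u}"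

lemma far_subset_outer: "u \<in> V \<Longrightarrow> far `` {u} \<subseteq> outer u"
  using outer_without_far by blast

text \<open>As \<open>d\<close> is even, \<open>odd_set u\<close> is meant to be the colour class
  opposite to \<open>u\<close>. Arcs inside it are excluded since far vertices have all neighbours
  in \<open>outer u\<close>; outside it, vertices reached in \<open>d - 2\<close> steps only have
  neighbours reached in \<open>d - 1\<close> steps, and the remaining ones fall under
  \<open>no_arc_within_outer\<close>.\<close>

lemma arc_crosses:
  assumes u: "u \<in> V" and vw: "(v, w) \<in> E" shows "v \<in> odd_set u \<longleftrightarrow> w \<notin> odd_set u"
proof -
  have wv: "(w, v) \<in> E" and V: "v \<in> V" "w \<in> V" using vw sym_E arcs_in_V by (auto dest: symD)
  have not_both: False if "x \<in> odd_set u" "y \<in> odd_set u" "(x, y) \<in> E" "(y, x) \<in> E" for x y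
  proof -
    have "x \<notin> far `` {u} \<or> y \<notin> (E ^^ (d - 1)) `` {u}" "y \<notin> far `` {u} \<or> x \<notin> (E ^^ (d - 1)) `` {u}"
      using outer_without_far[OF u] that(3,4) unfolding outer_def by blast+
    then show False using that no_arc_within_sphere no_arc_within_outer(2)[OF u]
      unfolding odd_set_def by blast
  qed
  have near: False if "x \<notin> odd_set u" "y \<notin> odd_set u" "(x, y) \<in> E" "(u, x) \<in> E ^^ (d - 2)" for x y
    using arc_from_near[OF that(4,3)] that(2) by (auto simp: odd_set_def)
  show ?thesis
  proof (rule ccontr)
    assume "\<not> ?thesis"
    then have "v \<notin> odd_set u" "w \<notin> odd_set u" using not_both vw wv by blast+
    with near[of v w] near[of w v] vw wv V
    have "v \<in> outer u - far `` {u}" "w \<in> outer u - far `` {u}"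
      by (auto simp: odd_set_def outer_def)
    with no_arc_within_outer(1)[OF u] vw show False by blast
  qed
qed

lemma walk_parity:
  assumes u: "u \<in> V" shows "(u, z) \<in> E ^^ n \<Longrightarrow> z \<in> odd_set u \<longleftrightarrow> odd n"
proof (induction n arbitrary: z)
  case 0
  have "(u, u) \<in> E ^^ (d - 2)" by (rule walk_extend[OF u, of _ 0]) (use even_d in auto)
  then have "u \<notin> odd_set u"
    using near_disjoint[of u] far_subset_outer[OF u] unfolding odd_set_def outer_def by blast
  with 0 show ?case by simp
next
  case (Suc n)
  then show ?case using arc_crosses[OF u] by (auto elim: relpow_Suc_E)
qed

lemma walks_same_parity:
  "u \<in> V \<Longrightarrow> (u, z) \<in> E ^^ m \<Longrightarrow> (u, z) \<in> E ^^ n \<Longrightarrow> even m \<longleftrightarrow> even n"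
  using walk_parity by blast

lemma odd_set_iff:
  assumes u: "u \<in> V" shows "z \<in> odd_set u \<longleftrightarrow> (u, z) \<in> E ^^ (d + 1)"
proof
  assume "z \<in> odd_set u"
  then show "(u, z) \<in> E ^^ (d + 1)"
    using walk_extend[OF u, of z "d - 1" "d + 1"] d_ge unfolding odd_set_def far_def by auto
next
  assume "(u, z) \<in> E ^^ (d + 1)"
  then show "z \<in> odd_set u" using walk_parity[OF u, of z "d + 1"] even_d by (simp del: relpow.simps)
qed

text \<open>Combines bipartiteness with diameter at most \<open>d + 1\<close>: a vertex of
  \<open>outer u\<close> that is not far has a neighbour outside \<open>outer u\<close>, which is
  reached in \<open>d - 1\<close> steps.\<close>

lemma even_walk_iff:
  assumes u: "u \<in> V" and z: "z \<in> V" shows "(u, z) \<in> E ^^ d \<longleftrightarrow> (u, z) \<notin> E ^^ (d + 1)"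
proof
  assume "(u, z) \<in> E ^^ d"
  then show "(u, z) \<notin> E ^^ (d + 1)" using walks_same_parity[OF u, of z d "d + 1"] by auto
next
  assume "(u, z) \<notin> E ^^ (d + 1)"
  then have z': "z \<notin> odd_set u" using odd_set_iff[OF u] by simp
  show "(u, z) \<in> E ^^ d"
  proof (cases "(u, z) \<in> E ^^ (d - 2)")
    case True
    then show ?thesis using walk_extend[OF u, of z "d - 2" d] d_ge by auto
  next
    case False
    with z z' have o: "z \<in> outer u" "z \<notin> far `` {u}" by (auto simp: outer_def odd_set_def)
    then obtain x where x: "(z, x) \<in> E" "x \<notin> outer u" using outer_without_far[OF u] by blast
    then have "(u, x) \<in> E ^^ (d - 1)"
      using outer_near_no_arc[OF o(1)] arcs_in_V unfolding outer_def by blast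
    then show ?thesis using x sym_E relpow_Suc_I[of u x "d - 1" E z] d_minus(2) by (auto dest: symD)
  qed
qed

section \<open>The excess operator, its harmonic functions, and the contradiction\<close>

lemma rsum_far:
  assumes u: "u \<in> V" shows "rsum (E ^^ (d + 1)) f u = rsum (E ^^ (d - 1)) f u + rsum far f u"
proof -
  \<comment> \<open>Walks of length \<open>d + 1\<close> reach the whole class opposite to
    \<open>u\<close>, so the operator of \<open>E ^^ (d + 1)\<close> is the operator
    \<open>K\<close> of the overview.\<close>
  have "of_bool ((u, z) \<in> E ^^ (d + 1)) = (of_bool ((u, z) \<in> E ^^ (d - 1)) + of_bool ((u, z) \<in> far) :: int)"
    for z
  proof -
    have "\<not> ((u, z) \<in> E ^^ (d - 1) \<and> (u, z) \<in> far)"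
      unfolding far_def using diff_le_self by blast
    moreover have "(u, z) \<in> E ^^ (d + 1) \<longleftrightarrow> (u, z) \<in> E ^^ (d - 1) \<or> (u, z) \<in> far"
      using odd_set_iff[OF u, of z] by (auto simp: odd_set_def)
    ultimately show ?thesis by (auto simp del: relpow.simps)
  qed
  then show ?thesis unfolding rsum_def by (simp add: sum.distrib distrib_right del: relpow.simps)
qed

text \<open>Both products have the entry \<open>k\<close> when \<open>z\<close> has the colour of
  \<open>u\<close>, and 0 otherwise.\<close>

lemma rsum_odd_commute:
  assumes u: "u \<in> V"
  shows "rsum E (rsum (E ^^ (d + 1)) f) u = rsum (E ^^ (d + 1)) (rsum E f) u"
proof -
  have "card {w \<in> V. (u, w) \<in> E \<and> (w, z) \<in> E ^^ (d + 1)} = card {w \<in> V. (u, w) \<in> E ^^ (d + 1) \<and> (w, z) \<in> E}"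
    if z: "z \<in> V" for z
  proof (cases "(u, z) \<in> E ^^ d")
    case True
    have "{w \<in> V. (u, w) \<in> E \<and> (w, z) \<in> E ^^ (d + 1)} = E `` {u}"
      using True sym_E arcs_in_V relpow_Suc_I2[of _ u E z d] by (auto dest: symD simp del: relpow.simps)
    moreover have "{w \<in> V. (u, w) \<in> E ^^ (d + 1) \<and> (w, z) \<in> E} = E `` {z}"
      using True sym_E arcs_in_V relpow_Suc_I[of u z d E] by (auto dest: symD simp del: relpow.simps)
    ultimately show ?thesis using regular u z by simp
  next
    case False
    then have uz: "(u, z) \<in> E ^^ (d + 1)" using even_walk_iff[OF u z] by blast
    have "(u, z) \<notin> E ^^ Suc (d + 1)" using walks_same_parity[OF u uz, of "Suc (d + 1)"] by auto
    then have "\<not> ((u, w) \<in> E \<and> (w, z) \<in> E ^^ (d + 1))" "\<not> ((u, w) \<in> E ^^ (d + 1) \<and> (w, z) \<in> E)" for w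
      using relpow_Suc_I2[of u w E z "d + 1"] relpow_Suc_I[of u w "d + 1" E z] by blast+
    then have "{w \<in> V. (u, w) \<in> E \<and> (w, z) \<in> E ^^ (d + 1)} = {}"
      "{w \<in> V. (u, w) \<in> E ^^ (d + 1) \<and> (w, z) \<in> E} = {}" by blast+
    then show ?thesis by (simp only:)
  qed
  then show ?thesis unfolding rsum_rsum by (simp del: relpow.simps)
qed

lemma rsum_far_commute:
  assumes u: "u \<in> V" shows "rsum E (rsum far f) u = rsum far (rsum E f) u"
proof -
  have far: "rsum far h v = 1 * rsum (E ^^ (d + 1)) h v + (- 1) * rsum (E ^^ (d - 1)) h v" if "v \<in> V" for h v
    using rsum_far[OF that] by simp
  have "rsum E (rsum far f) u = 1 * rsum E (rsum (E ^^ (d + 1)) f) u + (- 1) * rsum E (rsum (E ^^ (d - 1)) f) u"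
    unfolding rsum_linear[symmetric] by (rule rsum_cong) (rule far)
  then show ?thesis
    using rsum_odd_commute[OF u, of f] rsum_commute[OF u, of "d - 1" f] far[OF u, of "rsum E f"] d_ge by simp
qed

text \<open>Modulo constants, \<open>h\<close> is an eigenvector of the adjacency operator with
  eigenvalue \<open>t\<close>. Regularity maps constants to constants, so the recurrence of the walk
  operators becomes that of \<open>walk_poly\<close>.\<close>

lemma rsum_walk_poly:
  assumes h: "\<And>v. v \<in> V \<Longrightarrow> rsum E h v = t * h v + b" and "i + 1 \<le> d"
  shows "\<exists>c. \<forall>u\<in>V. rsum (E ^^ i) h u = walk_poly (int k - 1) t i * h u + c"
  using assms(2)
proof (induction i rule: induct_nat_012)
  case 0
  then show ?case using rsum_Id by (auto intro!: exI[of _ 0])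
next
  case 1
  then show ?case using h by (auto intro!: exI[of _ b])
next
  case (ge2 n)
  then obtain c0 c1 where c: "\<And>u. u \<in> V \<Longrightarrow> rsum (E ^^ n) h u = walk_poly (int k - 1) t n * h u + c0"
    "\<And>u. u \<in> V \<Longrightarrow> rsum (E ^^ Suc n) h u = walk_poly (int k - 1) t (Suc n) * h u + c1 * 1" by force
  have "rsum (E ^^ Suc (Suc n)) h u = walk_poly (int k - 1) t (Suc (Suc n)) * h u
      + (walk_poly (int k - 1) t (Suc n) * b + c1 * int k - (int k - 1) * c0)" if u: "u \<in> V" for u
  proof -
    have "rsum E (rsum (E ^^ Suc n) h) u = walk_poly (int k - 1) t (Suc n) * (t * h u + b) + c1 * int k"
      using rsum_cong[where R = E and u = u, OF c(2)] rsum_const[OF u, of 1] h[OF u] unfolding rsum_linear by simp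
    moreover have "rsum E (rsum (E ^^ Suc n) h) u = rsum (E ^^ Suc (Suc n)) h u + (int k - 1) * rsum (E ^^ n) h u"
      using rsum_recurrence[OF u, of "Suc n" h] ge2.prems by (simp del: relpow.simps)
    ultimately show ?thesis using c(1)[OF u] by (simp add: algebra_simps del: relpow.simps)
  qed
  then show ?case by blast
qed

text \<open>Maximum principle.\<close>

lemma far_harmonic_constant:
  assumes C: "C \<subseteq> V" "C \<noteq> {}" "far `` C \<subseteq> C"
    and conn: "\<And>S. S \<subseteq> C \<Longrightarrow> S \<noteq> {} \<Longrightarrow> far `` S \<subseteq> S \<Longrightarrow> S = C"
    and harm: "\<And>v. v \<in> C \<Longrightarrow> rsum far f v = 2 * f v"
  shows "\<exists>a. \<forall>v\<in>C. f v = a"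
proof -
  define a where "a = Max (f ` C)"
  define S where "S = {v \<in> C. f v = a}"
  have fin: "finite (f ` C)" using C finite_V finite_subset by blast
  have "a \<in> f ` C" unfolding a_def using fin C(2) by (intro Max_in) auto
  then have "S \<noteq> {}" by (auto simp: S_def)
  moreover have "far `` S \<subseteq> S"
  proof clarify
    fix v x assume v: "v \<in> S" and x: "(v, x) \<in> far"
    have vC: "v \<in> C" "f v = a" using v by (auto simp: S_def)
    obtain y y' where y: "far `` {v} = {y, y'}" "y \<noteq> y'"
      using card_far[of v] vC C(1) by (auto simp: card_2_iff)
    have "y \<in> C" "y' \<in> C" using y(1) vC(1) C(3) by blast+
    then have "f y \<le> a" "f y' \<le> a" unfolding a_def using fin by auto
    moreover have "far `` {v} \<subseteq> V" by (auto simp: far_def)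
    then have "f y + f y' = 2 * a" using harm[OF vC(1)] vC(2) y by (simp add: rsum_image)
    moreover have "x \<in> {y, y'}" using x y(1) by blast
    ultimately show "x \<in> S" using \<open>y \<in> C\<close> \<open>y' \<in> C\<close> by (auto simp: S_def)
  qed
  ultimately have "S = C" by (intro conn) (auto simp: S_def)
  then show ?thesis by (auto simp: S_def)
qed

text \<open>Each excess cycle enters as a nonempty set closed under \<open>far\<close> without a
  smaller nonempty closed subset, which is the form of connectedness that the maximum principle
  uses.\<close>

lemma no_two_far_components:
  assumes "odd k" and V: "V = C1 \<union> C2" "C1 \<inter> C2 = {}"
    and C1: "C1 \<noteq> {}" "far `` C1 \<subseteq> C1" "\<And>S. S \<subseteq> C1 \<Longrightarrow> S \<noteq> {} \<Longrightarrow> far `` S \<subseteq> S \<Longrightarrow> S = C1"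
    and C2: "C2 \<noteq> {}" "far `` C2 \<subseteq> C2" "\<And>S. S \<subseteq> C2 \<Longrightarrow> S \<noteq> {} \<Longrightarrow> far `` S \<subseteq> S \<Longrightarrow> S = C2"
  shows False
proof -
  define h :: "'a \<Rightarrow> int" where "h v = of_bool (v \<in> C1)" for v
  have farV: "far `` {v} \<subseteq> V" for v by (auto simp: far_def)
  have eh: "rsum far h v = 2 * h v" if v: "v \<in> V" for v
  proof -
    have "h z = h v" if "z \<in> far `` {v}" for z using that v V C1(2) C2(2) by (auto simp: h_def)
    then show ?thesis using rsum_image[OF farV] card_far[OF v] by simp
  qed
  have "rsum far (rsum E h) v = 2 * rsum E h v" if v: "v \<in> V" for v
  proof -
    have "rsum far (rsum E h) v = rsum E (rsum far h) v" using rsum_far_commute[OF v] by simp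
    also have "\<dots> = rsum E (\<lambda>v. 2 * h v + 0 * 0) v" by (rule rsum_cong) (simp add: eh)
    finally show ?thesis unfolding rsum_linear by simp
  qed
  then obtain a b where "\<forall>v\<in>C1. rsum E h v = a" "\<forall>v\<in>C2. rsum E h v = b"
    using far_harmonic_constant[OF _ C1, of "rsum E h"] far_harmonic_constant[OF _ C2, of "rsum E h"] V by blast
  then have "rsum E h v = (a - b) * h v + b" if "v \<in> V" for v
    using that V by (auto simp: h_def)
  then obtain c where c: "\<And>u. u \<in> V \<Longrightarrow> rsum (E ^^ (d - 1)) h u = walk_poly (int k - 1) (a - b) (d - 1) * h u + c"
    using rsum_walk_poly[of h "a - b" b "d - 1"] d_ge by auto
  have total: "rsum (E ^^ (d + 1)) h u = (walk_poly (int k - 1) (a - b) (d - 1) + 2) * h u + c" if "u \<in> V" for u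
    using rsum_far[OF that] c[OF that] eh[OF that] by (simp add: algebra_simps)
  obtain u where u: "u \<in> C1" "u \<in> V" using C1(1) V by auto
  \<comment> \<open>A vertex of the second cycle with the colour of \<open>u\<close>: if
    \<open>y\<close> has the wrong colour, its excess neighbour \<open>y'\<close> is in the same
    cycle and, as \<open>d + 1\<close> is odd, has the other colour.\<close>
  obtain x where x: "x \<in> C2" "(u, x) \<in> E ^^ d"
  proof -
    obtain y where y: "y \<in> C2" "y \<in> V" using C2(1) V by auto
    have "far `` {y} \<noteq> {}" using card_far[OF y(2)] by force
    then obtain y' where y': "(y, y') \<in> far" by auto
    then have y'V: "y' \<in> C2" "y' \<in> V" "(y, y') \<in> E ^^ (d + 1)" using y C2(2) by (auto simp: far_def)
    show ?thesis
    proof (cases "(u, y) \<in> E ^^ d")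
      case True
      with y show ?thesis by (intro that)
    next
      case False
      then have "(u, y) \<in> E ^^ (d + 1)" using even_walk_iff u y by blast
      then have "(u, y') \<in> E ^^ (d + 1 + (d + 1))" using y'V(3) walk_join by blast
      then have "(u, y') \<notin> E ^^ (d + 1)"
        using walks_same_parity[OF u(2), of y' "d + 1 + (d + 1)" "d + 1"] even_d by (auto simp del: relpow.simps)
      then show ?thesis using that y'V even_walk_iff u by blast
    qed
  qed
  have xV: "x \<in> V" using x V by auto
  have "(u, z) \<in> E ^^ (d + 1) \<longleftrightarrow> (x, z) \<in> E ^^ (d + 1)" if z: "z \<in> V" for z
  proof
    assume "(x, z) \<in> E ^^ (d + 1)"
    then have "(u, z) \<in> E ^^ (d + (d + 1))" using x walk_join by blast
    then show "(u, z) \<in> E ^^ (d + 1)"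
      using walk_parity[OF u(2), of z "d + (d + 1)"] odd_set_iff[OF u(2)] by (simp del: relpow.simps)
  next
    assume "(u, z) \<in> E ^^ (d + 1)"
    then have "(x, z) \<in> E ^^ (d + (d + 1))" using walk_rev[OF x(2)] walk_join by blast
    then show "(x, z) \<in> E ^^ (d + 1)"
      using walk_parity[OF xV, of z "d + (d + 1)"] odd_set_iff[OF xV] by (simp del: relpow.simps)
  qed
  then have "rsum (E ^^ (d + 1)) h u = rsum (E ^^ (d + 1)) h x" by (simp add: rsum_def del: relpow.simps)
  moreover have "h u = 1" "h x = 0" using u x V by (auto simp: h_def)
  \<comment> \<open>Equal colours give equal sums over the opposite class, so subtracting
    \<open>total\<close> at \<open>x\<close> from \<open>total\<close> at \<open>u\<close> cancels
    \<open>c\<close>.\<close>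
  ultimately have "walk_poly (int k - 1) (a - b) (d - 1) = - 2" using total[OF u(2)] total[OF xV] by simp
  then show False using walk_poly_neq[of "int k - 1" "d - 1"] \<open>odd k\<close> d_ge by auto
qed

end

section \<open>Library walks, distance and girth in terms of relation powers\<close>

lemma awalk_length_iff_relpow:
  assumes "pair_graph G"
  shows "(\<exists>p. pre_digraph.awalk (with_proj G) u p v \<and> length p = n) \<longleftrightarrow> u \<in> pverts G \<and> (u, v) \<in> parcs G ^^ n"
proof (induction n arbitrary: u)
  case 0
  then show ?case by (auto simp: pre_digraph.awalk_def cas_with_proj_eq)
next
  case (Suc n)
  interpret pair_graph G by fact
  have "(\<exists>p. awalk u p v \<and> length p = Suc n) \<longleftrightarrow> (\<exists>w. (u, w) \<in> parcs G \<and> (\<exists>p. awalk w p v \<and> length p = n))"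
  proof
    assume "\<exists>p. awalk u p v \<and> length p = Suc n"
    then show "\<exists>w. (u, w) \<in> parcs G \<and> (\<exists>p. awalk w p v \<and> length p = n)"
      by (force simp: length_Suc_conv awalk_Cons_iff)
  next
    assume "\<exists>w. (u, w) \<in> parcs G \<and> (\<exists>p. awalk w p v \<and> length p = n)"
    then obtain w p where "(u, w) \<in> parcs G" "awalk w p v" "length p = n" by blast
    then have "awalk u ((u, w) # p) v" "length ((u, w) # p) = Suc n" by (auto simp: awalk_Cons_iff)
    then show "\<exists>p. awalk u p v \<and> length p = Suc n" by blast
  qed
  also have "\<dots> \<longleftrightarrow> u \<in> pverts G \<and> (u, v) \<in> parcs G ^^ Suc n"
    unfolding Suc.IH using wellformed' relpow_Suc_D2 relpow_Suc_I2 by metis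
  finally show ?case .
qed

lemma graph_dist_eq_iff:
  assumes "pair_graph G" "u \<in> pverts G"
  shows "graph_dist G u v = ereal (real n) \<longleftrightarrow> (u, v) \<in> parcs G ^^ n \<and> (\<forall>j<n. (u, v) \<notin> parcs G ^^ j)"
proof -
  interpret pair_graph G by fact
  have cost: "awalk_cost (\<lambda>_. 1) p = real (length p)" for p by (induction p) auto
  have dist: "graph_dist G u v = (INF p \<in> {p. awalk u p v}. ereal (real (length p)))"
    unfolding graph_dist_def \<mu>_def cost ..
  note walk = awalk_length_iff_relpow[OF assms(1), of u v]
  have shortest: "graph_dist G u v = ereal (real m)"
    if m: "(u, v) \<in> parcs G ^^ m" "\<forall>j<m. (u, v) \<notin> parcs G ^^ j" for m
  proof (rule antisym)
    obtain p where "awalk u p v" "length p = m" using walk[of m] m assms(2) by blast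
    then show "graph_dist G u v \<le> ereal (real m)" unfolding dist by (intro INF_lower2[of p]) auto
    have "m \<le> length p" if "awalk u p v" for p using walk[of "length p"] that m(2) not_le by blast
    then show "ereal (real m) \<le> graph_dist G u v" unfolding dist by (intro INF_greatest) auto
  qed
  show ?thesis
  proof
    assume n: "graph_dist G u v = ereal (real n)"
    have "{p. awalk u p v} \<noteq> {}"
    proof
      assume "{p. awalk u p v} = {}"
      then have "graph_dist G u v = \<infinity>" unfolding dist by (simp only: INF_empty top_ereal_def)
      with n show False by simp
    qed
    then have "\<exists>m. (u, v) \<in> parcs G ^^ m" using walk by blast
    then obtain m where "(u, v) \<in> parcs G ^^ m" "\<forall>j<m. (u, v) \<notin> parcs G ^^ j"
      using exists_least_iff[of "\<lambda>m. (u, v) \<in> parcs G ^^ m"] by blast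
    with shortest[of m] n show "(u, v) \<in> parcs G ^^ n \<and> (\<forall>j<n. (u, v) \<notin> parcs G ^^ j)" by simp
  qed (use shortest in blast)
qed

lemma girth_le:
  assumes G: "pair_graph G" and n: "3 \<le> n" and inj: "inj_on p {..<n}"
    and arcs: "\<And>i. i < n \<Longrightarrow> (p i, p (Suc i)) \<in> parcs G" and closed: "p n = p 0"
  shows "girth G \<le> enat n"
proof -
  interpret pair_graph G by fact
  \<comment> \<open>The arc list is generalised to its suffixes, so that the walk property can be
    proved by downward induction from \<open>n\<close>.\<close>
  define c where "c j = map (\<lambda>i. (p i, p (Suc i))) [j..<n]" for j
  have c_rec: "c j = (p j, p (Suc j)) # c (Suc j)" if "j < n" for j
    using that by (simp add: c_def upt_conv_Cons)
  have "pcas (p j) (c j) (p n) \<and> pawalk_verts (p j) (c j) = map p [j..<Suc n]" if "j \<le> n" for j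
    using that
  proof (induction rule: inc_induct)
    case base
    then show ?case by (simp add: c_def)
  next
    case (step j)
    have "[j..<Suc n] = j # [Suc j..<Suc n]" using step.hyps by (simp add: upt_conv_Cons del: upt_Suc)
    then show ?case using step c_rec by (simp del: upt_Suc)
  qed
  from this[of 0] have c: "pcas (p 0) (c 0) (p 0)" "pawalk_verts (p 0) (c 0) = map p [0..<Suc n]"
    using closed by auto
  have "set (c 0) \<subseteq> parcs G" using arcs by (auto simp: c_def)
  moreover have "p 0 \<in> pverts G" using arcs[of 0] n wellformed' by auto
  ultimately have "awalk (p 0) (c 0) (p 0)" using c by (simp add: awalk_def)
  moreover have "distinct (tl (pawalk_verts (p 0) (c 0)))"
  proof -
    have "tl (map p [0..<Suc n]) = map p [1..<n] @ [p 0]"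
      using n closed by (simp add: upt_conv_Cons[of 0])
    moreover have "p ` {1..<n} \<inter> {p 0} = {}" using n by (auto dest: inj_onD[OF inj, of 0])
    ultimately show ?thesis unfolding c(2) using inj by (auto simp: distinct_map inj_on_def)
  qed
  ultimately have "graph_cycle G (c 0)" using n unfolding graph_cycle_def cycle_def by (auto simp: c_def)
  moreover have "length (c 0) = n" by (simp add: c_def)
  ultimately show ?thesis unfolding girth_def by (intro INF_lower2[of "c 0"]) auto
qed

lemma kg_graph_imp_regular_girth_graph:
  assumes "kg_graph k (2 * d) G" "k \<ge> 1"
  shows "regular_girth_graph (pverts G) (parcs G) k d"
proof -
  have G: "pair_graph G" "\<And>v. v \<in> pverts G \<Longrightarrow> out_degree (with_proj G) v = k" "girth G = enat (2 * d)"
    using assms by (auto simp: kg_graph_def)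
  interpret pair_graph G by fact
  show ?thesis
  proof
    show "finite (pverts G)" by (rule pair_finite_verts)
    show "parcs G \<subseteq> pverts G \<times> pverts G" using wellformed' by auto
    show "sym (parcs G)" using pair_sym_arcs by (simp add: symmetric_def)
    show "irrefl (parcs G)" using pair_no_loops by (fastforce simp: irrefl_def)
    show "card (parcs G `` {u}) = k" if "u \<in> pverts G" for u
    proof -
      have "{e \<in> parcs G. fst e = u} = Pair u ` (parcs G `` {u})" by force
      then show ?thesis using G(2)[OF that] by (simp add: out_degree_def out_arcs_def card_image inj_on_def)
    qed
    show "2 * d \<le> n" if "3 \<le> n" "inj_on p {..<n}" "\<And>i. i < n \<Longrightarrow> (p i, p (Suc i)) \<in> parcs G" "p n = p 0"
      for n p using girth_le[OF G(1) that] G(3) by simp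
  qed (fact assms(2))
qed

lemma excess_graph_arcs:
  assumes "pair_graph G"
  shows "parcs (excess_graph d G) =
    {(u, z) \<in> pverts G \<times> pverts G. (u, z) \<in> parcs G ^^ (d + 1) \<and> (\<forall>j\<le>d. (u, z) \<notin> parcs G ^^ j)}"
proof -
  have "graph_dist G u z = ereal (real (d + 1)) \<longleftrightarrow> (u, z) \<in> parcs G ^^ (d + 1) \<and> (\<forall>j\<le>d. (u, z) \<notin> parcs G ^^ j)"
    if "u \<in> pverts G" for u z
    unfolding graph_dist_eq_iff[OF assms that] by (simp only: Suc_eq_plus1[symmetric] less_Suc_eq_le)
  then show ?thesis unfolding excess_graph_def by (auto simp del: relpow.simps of_nat_Suc of_nat_add)
qed

section \<open>Connectedness and 2-regularity of cycle graphs\<close>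

lemma pcas_connects:
  assumes "pcas u p v" "\<And>x y. (x, y) \<in> set p \<Longrightarrow> x \<in> S \<longleftrightarrow> y \<in> S" "e \<in> set p"
  shows "fst e \<in> S \<longleftrightarrow> u \<in> S"
  using assms
proof (induction p arbitrary: u)
  case (Cons a p)
  then have "pcas (snd a) p v" "fst a = u" "fst a \<in> S \<longleftrightarrow> snd a \<in> S" by (auto simp: prod_eq_iff)
  with Cons show ?case by auto
qed simp

lemma pcas_nth:
  assumes "pcas u p v"
  shows "Suc i < length p \<Longrightarrow> snd (p ! i) = fst (p ! Suc i)"
    and "p \<noteq> [] \<Longrightarrow> fst (p ! 0) = u \<and> snd (last p) = v"
  using assms
proof (induction p arbitrary: u i)
  case (Cons a p)
  {
    case 1
    then show ?case using Cons.IH(2)[of "snd a"] Cons.IH(1)[of _ "snd a"] by (cases i) auto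
  next
    case 2
    then show ?case using Cons.IH(2)[of "snd a"] by auto
  }
qed auto

text \<open>The arc set contains all converses, so closure under arcs makes membership in
  \<open>S\<close> constant along each arc of \<open>p\<close> and hence along the whole
  cycle.\<close>

lemma is_cycle_graph_connected:
  assumes H: "is_cycle_graph H" and S: "S \<subseteq> pverts H" "S \<noteq> {}" "parcs H `` S \<subseteq> S"
  shows "S = pverts H"
proof -
  obtain p u where p: "pcas u p u" "pverts H = fst ` set p" "parcs H = set p \<union> (set p)\<inverse>"
    using H by (auto simp: is_cycle_graph_def graph_cycle_def pre_digraph.cycle_def pre_digraph.awalk_def
        cas_with_proj_eq)
  have "fst e \<in> S \<longleftrightarrow> u \<in> S" if "e \<in> set p" for e
    using S(3) p(3) that by (intro pcas_connects[OF p(1)]) auto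
  then have "x \<in> S \<longleftrightarrow> u \<in> S" if "x \<in> pverts H" for x using that p(2) by auto
  then show ?thesis using S(1,2) by blast
qed

text \<open>With the vertices of \<open>p\<close> indexed cyclically by an injective
  \<open>c\<close>, the neighbours of a vertex are its cyclic successor and predecessor, which
  differ because the length is at least 3.\<close>

lemma is_cycle_graph_degree:
  fixes H :: "'a pair_pre_digraph"
  assumes H: "is_cycle_graph H" and v: "v \<in> pverts H"
  shows "card (parcs H `` {v}) = 2"
proof -
  obtain p u where p: "pcas u p u" "distinct (tl (pawalk_verts u p))" "3 \<le> length p"
      "pverts H = fst ` set p" "parcs H = set p \<union> (set p)\<inverse>"
    using H by (auto simp: is_cycle_graph_def graph_cycle_def pre_digraph.cycle_def pre_digraph.awalk_def
        cas_with_proj_eq awalk_verts_with_proj_eq)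
  define m c where "m = length p" and "c i = fst (p ! i)" for i
  have m: "m \<ge> 3" "p \<noteq> []" using p(3) by (auto simp: m_def)
  have "pawalk_verts w q = w # map snd q" if "pcas w q w'" for w w' :: 'a and q
    using that by (induction q arbitrary: w) auto
  then have dist: "distinct (map snd p)" using p(1,2) by simp
  have next_fst: "snd (p ! i) = c (Suc i mod m)" if "i < m" for i
  proof (cases "Suc i = m")
    case True
    then have "last p = p ! i" using m(2) by (metis diff_Suc_1 last_conv_nth m_def)
    then show ?thesis using pcas_nth(2)[OF p(1) m(2)] True by (simp add: c_def)
  next
    case False
    then show ?thesis using pcas_nth(1)[OF p(1), of i] that by (simp add: c_def m_def)
  qed
  have "p ! i = (c i, c (Suc i mod m))" if "i < m" for i
    using next_fst[OF that] by (simp add: c_def prod_eq_iff)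
  moreover have "set p = (!) p ` {..<m}" by (auto simp: set_conv_nth m_def)
  ultimately have arcs: "set p = (\<lambda>i. (c i, c (Suc i mod m))) ` {..<m}" by simp
  have inj: "inj_on c {..<m}"
  proof (rule eq_card_imp_inj_on)
    \<comment> \<open>The library's condition makes the heads of the arcs distinct; every head is
      the tail of the next arc, so the tails take \<open>m\<close> values as well.\<close>
    have "snd ` set p \<subseteq> c ` {..<m}" using m by (auto simp: arcs)
    then have "card (snd ` set p) \<le> card (c ` {..<m})" by (intro card_mono) auto
    moreover have "card (snd ` set p) = m" using distinct_card[OF dist] by (simp add: m_def)
    ultimately show "card (c ` {..<m}) = card {..<m}" using card_image_le[of "{..<m}" c] by simp
  qed simp
  obtain i where i: "i < m" "v = c i" using v p(4) arcs by auto
  define j where "j = (if i = 0 then m - 1 else i - 1)"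
  have j: "j < m" "Suc j mod m = i" using i m by (auto simp: j_def)
  have uniq: "Suc l mod m = i \<longleftrightarrow> l = j" if "l < m" for l
    using that i m by (auto simp: j_def mod_Suc split: if_splits)
  have c_eq: "c a = c b \<longleftrightarrow> a = b" if "a < m" "b < m" for a b using inj that by (auto simp: inj_on_def)
  have "parcs H `` {v} = {c (Suc i mod m), c j}"
  proof -
    have "(v, x) \<in> set p \<longleftrightarrow> x = c (Suc i mod m)" for x using i c_eq by (auto simp: arcs)
    moreover have "(x, v) \<in> set p \<longleftrightarrow> x = c j" for x
    proof -
      have "v = c (Suc l mod m) \<longleftrightarrow> l = j" if "l < m" for l
        using c_eq[of "Suc l mod m" i] uniq[OF that] i m by auto
      moreover have "(x, v) \<in> set p \<longleftrightarrow> (\<exists>l<m. x = c l \<and> v = c (Suc l mod m))" by (auto simp: arcs)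
      ultimately show ?thesis using j(1) by blast
    qed
    ultimately show ?thesis unfolding p(5) by auto
  qed
  moreover have "c (Suc i mod m) \<noteq> c j"
    using c_eq[of "Suc i mod m" j] i j m by (auto simp: j_def mod_Suc split: if_splits)
  ultimately show ?thesis by simp
qed

theorem theorem3p4:
  fixes k g d :: nat
  assumes "k \<ge> 7" and "odd k" and "g = 2 * d" and "g \<ge> 8" and "even d"
  shows "\<not> (\<exists>G :: 'a pair_pre_digraph. bicyclic_excess_4 k g G)"
proof
  assume "\<exists>G :: 'a pair_pre_digraph. bicyclic_excess_4 k g G"
  then obtain G :: "'a pair_pre_digraph" where G: "kg_graph k (2 * d) G" "excess k (2 * d) G = 4"
      "disjoint_union_of_two_cycles (excess_graph d G)"
    using assms(3) by (auto simp: bicyclic_excess_4_def)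
  then have pg: "pair_graph G" by (simp add: kg_graph_def)
  interpret girth: regular_girth_graph "pverts G" "parcs G" k d
    using kg_graph_imp_regular_girth_graph[OF G(1)] assms(1) by simp
  obtain C1 C2 where C: "is_cycle_graph C1" "is_cycle_graph C2" "pverts C1 \<inter> pverts C2 = {}"
    and V: "pverts G = pverts C1 \<union> pverts C2" and arcs: "parcs (excess_graph d G) = parcs C1 \<union> parcs C2"
    using G(3) by (auto simp: disjoint_union_of_two_cycles_def excess_graph_def)
  have far: "girth.far = parcs C1 \<union> parcs C2"
    unfolding arcs[symmetric] girth.far_def excess_graph_arcs[OF pg] ..
  have sub: "parcs C \<subseteq> pverts C \<times> pverts C" "pverts C \<noteq> {}" if "is_cycle_graph C" for C :: "'a pair_pre_digraph"
  proof -
    interpret pair_graph C using that by (simp add: is_cycle_graph_def)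
    show "parcs C \<subseteq> pverts C \<times> pverts C" using wellformed' by auto
    show "pverts C \<noteq> {}" using that by (auto simp: is_cycle_graph_def graph_cycle_def)
  qed
  \<comment> \<open>As the cycles have disjoint vertex sets, the excess relation restricted to
    either of them is the arc set of that cycle alone.\<close>
  have far1: "girth.far `` S = parcs C1 `` S" if "S \<subseteq> pverts C1" for S
    unfolding far using sub(1)[OF C(2)] C(3) that by blast
  have far2: "girth.far `` S = parcs C2 `` S" if "S \<subseteq> pverts C2" for S
    unfolding far using sub(1)[OF C(1)] C(3) that by blast
  interpret excess_four_graph "pverts G" "parcs G" k d
  proof
    show "k \<ge> 7" "d \<ge> 4" "even d" using assms by auto
    have "int (card (pverts G)) = int (2 * (\<Sum>j<d. (k - 1) ^ j) + 4)"
      using G(2) by (simp add: excess_def moore_bound_even_def)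
    then show "card (pverts G) = 2 * (\<Sum>j<d. (k - 1) ^ j) + 4" by linarith
    show "card (girth.far `` {u}) = 2" if "u \<in> pverts G" for u
      using that V far1[of "{u}"] far2[of "{u}"] is_cycle_graph_degree[OF C(1)] is_cycle_graph_degree[OF C(2)]
      by auto
  qed
  show False
  proof (rule no_two_far_components[OF assms(2) V C(3)])
    show "pverts C1 \<noteq> {}" "pverts C2 \<noteq> {}" using sub(2) C by auto
    show "girth.far `` pverts C1 \<subseteq> pverts C1" "girth.far `` pverts C2 \<subseteq> pverts C2"
      unfolding far1[OF subset_refl] far2[OF subset_refl] using sub(1)[OF C(1)] sub(1)[OF C(2)] by auto
    show "S = pverts C1" if "S \<subseteq> pverts C1" "S \<noteq> {}" "girth.far `` S \<subseteq> S" for S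
      using is_cycle_graph_connected[OF C(1) that(1,2)] that(3) far1[OF that(1)] by simp
    show "S = pverts C2" if "S \<subseteq> pverts C2" "S \<noteq> {}" "girth.far `` S \<subseteq> S" for S
      using is_cycle_graph_connected[OF C(2) that(1,2)] that(3) far2[OF that(1)] by simp
  qed
qed

end
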